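(* Let $\|\cdot\|$ be a sequential norm with $\|\cdot\|_\infty\le\|\cdot\|\le\|\cdot\|_1$. Let $N$ be a random variable with values in $\{1,2,\dots\}$, let $(X_i)_{i\ge1}$ be nonnegative random variables and, for each $n\ge 1$, let $A(n)=(a_{i,j})_{1\le i,j\le n}$ be a random $n\times n$ matrix, where $N$, $(X_i)_{i\ge1}$ and the matrices $(A(n))_{n\ge 1}$ are independent of one another. Put $X(N)=(X_1,\dots,X_N)'$ and $C(N)=A(N)X(N)$, and assume that the components of $C(N)$ are nonnegative. Assume that for some $\alpha>0$: (i) $\mathbb{E}[N]>0$ and $\mathbb{E}[N^{2+\alpha+\epsilon}]<\infty$ for some $\epsilon>0$; (ii) the $X_i$ are identically distributed with common mean $\gamma$, and $x\mapsto\mathbb{P}(X_1>x)$ is regularly varying at infinity with index $-\alpha$; (iii) $\displaystyle\sup_{i\ne j}\frac{\mathbb{P}(X_i>x,\,X_j>x)}{\mathbb{P}(X_1>x)}\to0$ as $x\to\infty$; (iv) there is $\epsilon>0$ such that $\mathbb{E}\big[\|A(N)\|^{\alpha+\epsilon}N^{1+\alpha+\epsilon}\big]<\infty$. Then $$\lim_{x\to\infty}\frac{\mathbb{P}(\|C(N)\|>x)}{\mathbb{P}(X_1>x)}=\mathbb{E}\Big[\sum_{k=1}^{N}\|A_k(N)\|^{\alpha}\Big].$$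
   Context: A finite vector $(u_1,\dots,u_n)$ is identified with the sequence $(u_1,\dots,u_n,0,0,\dots)$, and $\|\cdot\|$ is a norm on such finitely supported sequences (for example any $\ell^p$ norm, $1\le p\le\infty$); the same symbol applied to an $n\times n$ matrix denotes the operator norm induced by $\|\cdot\|$ on $\mathbb{R}^n$. $A_k(N)$ denotes the $k$-th column of $A(N)$, viewed as a vector. The matrix $A(N)$ and the vector $X(N)$ are dependent only through their common random dimension $N$. *)

theory Defs
  imports "HOL-Probability.Probability"
begin

text \<open>
  Sequences \<open>(u\<^sub>1, u\<^sub>2, \<dots>)\<close> are functions on \<open>nat\<close> whose positions are \<open>1, 2, \<dots>\<close>; position
  \<open>0\<close> is unused and carries the value \<open>0\<close>.
\<close>

definition fin_seqs :: "(nat \<Rightarrow> real) set" where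
  "fin_seqs = {u. finite {i. u i \<noteq> 0} \<and> u 0 = 0}"

definition sup_norm :: "(nat \<Rightarrow> real) \<Rightarrow> real" where
  "sup_norm u = (SUP i. \<bar>u i\<bar>)"

definition l1_norm :: "(nat \<Rightarrow> real) \<Rightarrow> real" where
  "l1_norm u = (\<Sum>i | u i \<noteq> 0. \<bar>u i\<bar>)"

definition sequential_norm :: "((nat \<Rightarrow> real) \<Rightarrow> real) \<Rightarrow> bool" where
  "sequential_norm nrm \<longleftrightarrow>
     (\<forall>u\<in>fin_seqs. 0 \<le> nrm u) \<and>
     (\<forall>u\<in>fin_seqs. nrm u = 0 \<longleftrightarrow> u = (\<lambda>i. 0)) \<and>
     (\<forall>u\<in>fin_seqs. \<forall>c. nrm (\<lambda>i. c * u i) = \<bar>c\<bar> * nrm u) \<and>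
     (\<forall>u\<in>fin_seqs. \<forall>v\<in>fin_seqs. nrm (\<lambda>i. u i + v i) \<le> nrm u + nrm v)"

text \<open>The vector \<open>(u\<^sub>1, \<dots>, u\<^sub>n)\<close>, identified with \<open>(u\<^sub>1, \<dots>, u\<^sub>n, 0, 0, \<dots>)\<close>.\<close>

definition fin_vec :: "nat \<Rightarrow> (nat \<Rightarrow> real) \<Rightarrow> nat \<Rightarrow> real" where
  "fin_vec n u = (\<lambda>i. if i \<in> {1..n} then u i else 0)"

text \<open>
  An \<open>n \<times> n\<close> matrix is a function \<open>B\<close> of which only the entries \<open>B i j\<close> with
  \<open>i, j \<in> {1..n}\<close> are ever used.
\<close>

definition mat_vec :: "nat \<Rightarrow> (nat \<Rightarrow> nat \<Rightarrow> real) \<Rightarrow> (nat \<Rightarrow> real) \<Rightarrow> nat \<Rightarrow> real" where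
  "mat_vec n B u = fin_vec n (\<lambda>i. \<Sum>j=1..n. B i j * u j)"

definition mat_col :: "nat \<Rightarrow> (nat \<Rightarrow> nat \<Rightarrow> real) \<Rightarrow> nat \<Rightarrow> nat \<Rightarrow> real" where
  "mat_col n B k = fin_vec n (\<lambda>i. B i k)"

text \<open>For \<open>n \<ge> 1\<close> the supremum is over a nonempty set, bounded above for every norm.\<close>

definition op_norm :: "((nat \<Rightarrow> real) \<Rightarrow> real) \<Rightarrow> nat \<Rightarrow> (nat \<Rightarrow> nat \<Rightarrow> real) \<Rightarrow> real" where
  "op_norm nrm n B =
     (SUP u \<in> range (fin_vec n) - {\<lambda>i. 0}. nrm (mat_vec n B u) / nrm u)"

definition regularly_varying :: "(real \<Rightarrow> real) \<Rightarrow> real \<Rightarrow> bool" where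
  "regularly_varying f \<rho> \<longleftrightarrow>
     (\<exists>a. (\<forall>x\<ge>a. 0 < f x) \<and> set_borel_measurable borel {a..} f) \<and>
     (\<forall>t>0. ((\<lambda>x. f (t * x) / f x) \<longlongrightarrow> t powr \<rho>) at_top)"

text \<open>
  Mutual independence of three random elements. The library's \<open>indep_vars\<close> needs a common
  codomain type, so independence is stated for the generated sigma-algebras.
\<close>

definition indep_three ::
  "'w measure \<Rightarrow> 'a measure \<Rightarrow> ('w \<Rightarrow> 'a) \<Rightarrow> 'b measure \<Rightarrow> ('w \<Rightarrow> 'b) \<Rightarrow>
     'c measure \<Rightarrow> ('w \<Rightarrow> 'c) \<Rightarrow> bool" where
  "indep_three M K U L V R W \<longleftrightarrow>
     U \<in> M \<rightarrow>\<^sub>M K \<and> V \<in> M \<rightarrow>\<^sub>M L \<and> W \<in> M \<rightarrow>\<^sub>M R \<and>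
     prob_space.indep_sets M
       (\<lambda>k. [sets (vimage_algebra (space M) U K),
             sets (vimage_algebra (space M) V L),
             sets (vimage_algebra (space M) W R)] ! k) {0, 1, 2}"

definition mat_entries :: "(nat \<times> nat \<times> nat) set" where
  "mat_entries = {(n, i, j). i \<in> {1..n} \<and> j \<in> {1..n}}"

end

theory Submission
  imports Defs
begin

text \<open>
  Condition on \<open>N\<close> and the matrices. For a fixed \<open>n \<times> n\<close> matrix \<open>B\<close>, the norm of \<open>B X\<close> exceeds
  a large level essentially only if a single \<open>\<parallel>B\<^sub>k\<parallel> X\<^sub>k\<close> does, since two coordinates are rarely large
  together by (iii); regular variation then turns the tail ratio into the sum of the
  \<open>\<parallel>B\<^sub>k\<parallel>\<^sup>\<alpha>\<close>. The passage to random \<open>N\<close> and \<open>A(N)\<close> is dominated convergence: \<open>\<parallel>B X\<parallel>\<close> is at most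
  \<open>n \<parallel>B\<parallel>\<close> times the largest coordinate of \<open>X\<close>, so a Potter-type bound on the tail dominates the
  ratio by a multiple of \<open>n (1 + (n \<parallel>B\<parallel>)\<^sup>p)\<close> with \<open>p = \<alpha> + \<epsilon>\<close>, which is integrable by (i) and (iv).
\<close>

subsection \<open>Norms between the supremum norm and the \<open>\<ell>\<^sup>1\<close> norm\<close>

lemma fin_vec_in_fin_seqs [simp]: "fin_vec n u \<in> fin_seqs"
proof -
  have "{i. fin_vec n u i \<noteq> 0} \<subseteq> {1..n}" by (auto simp: fin_vec_def)
  then show ?thesis
    by (auto simp: fin_seqs_def fin_vec_def intro: finite_subset)
qed

lemma mat_vec_in_fin_seqs [simp]: "mat_vec n B u \<in> fin_seqs"
  by (simp add: mat_vec_def)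

lemma mat_col_in_fin_seqs [simp]: "mat_col n B k \<in> fin_seqs"
  by (simp add: mat_col_def)

lemma fin_seqs_scale: "u \<in> fin_seqs \<Longrightarrow> (\<lambda>i. c * u i) \<in> fin_seqs"
  by (auto simp: fin_seqs_def)

lemma fin_seqs_add:
  assumes "u \<in> fin_seqs" "v \<in> fin_seqs"
  shows "(\<lambda>i. u i + v i) \<in> fin_seqs"
proof -
  have "{i. u i + v i \<noteq> 0} \<subseteq> {i. u i \<noteq> 0} \<union> {i. v i \<noteq> 0}" by auto
  then show ?thesis
    using assms unfolding fin_seqs_def
    by (auto intro: finite_subset[of "{i. u i + v i \<noteq> 0}" "{i. u i \<noteq> 0} \<union> {i. v i \<noteq> 0}"])
qed

lemma fin_seqs_lincomb:
  assumes "finite J" "\<And>j. j \<in> J \<Longrightarrow> v j \<in> fin_seqs"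
  shows "(\<lambda>i. \<Sum>j\<in>J. c j * v j i) \<in> fin_seqs"
  using assms
proof (induction J rule: finite_induct)
  case empty
  then show ?case by (simp add: fin_seqs_def)
next
  case (insert j J)
  then show ?case by (simp add: fin_seqs_add fin_seqs_scale)
qed

lemma mat_vec_eq_lincomb: "mat_vec n B u = (\<lambda>i. \<Sum>j=1..n. u j * mat_col n B j i)"
  by (auto simp: mat_vec_def mat_col_def fin_vec_def fun_eq_iff mult.commute intro!: sum.cong)

lemma mat_vec_fin_vec [simp]: "mat_vec n B (fin_vec n u) = mat_vec n B u"
  by (auto simp: mat_vec_def fin_vec_def fun_eq_iff intro!: sum.cong)

lemma mat_vec_cong:
  assumes "\<And>i j. i \<in> {1..n} \<Longrightarrow> j \<in> {1..n} \<Longrightarrow> B i j = B' i j"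
    and "\<And>j. j \<in> {1..n} \<Longrightarrow> u j = u' j"
  shows "mat_vec n B u = mat_vec n B' u'"
  using assms by (auto simp: mat_vec_def fin_vec_def fun_eq_iff intro!: sum.cong)

text \<open>A finitely supported sequence takes finitely many values, so the real supremum is over a
  bounded set.\<close>

lemma abs_le_sup_norm:
  assumes "u \<in> fin_seqs"
  shows "\<bar>u i\<bar> \<le> sup_norm u"
proof -
  have "range (\<lambda>i. \<bar>u i\<bar>) \<subseteq> insert 0 ((\<lambda>i. \<bar>u i\<bar>) ` {i. u i \<noteq> 0})" by auto
  with assms have "finite (range (\<lambda>i. \<bar>u i\<bar>))"
    by (auto simp: fin_seqs_def intro: finite_subset)
  then show ?thesis
    unfolding sup_norm_def by (intro cSUP_upper) (auto intro: bdd_above_finite)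
qed

lemma l1_norm_fin_vec: "l1_norm (fin_vec n u) = (\<Sum>i=1..n. \<bar>u i\<bar>)"
proof -
  have "l1_norm (fin_vec n u) = (\<Sum>i=1..n. \<bar>fin_vec n u i\<bar>)"
    unfolding l1_norm_def by (rule sum.mono_neutral_left) (auto simp: fin_vec_def)
  also have "\<dots> = (\<Sum>i=1..n. \<bar>u i\<bar>)" by (auto simp: fin_vec_def)
  finally show ?thesis .
qed

section \<open>Triangle inequalities, operator norm and measurability for an intermediate
  norm\<close>

locale intermediate_norm =
  fixes nrm :: "(nat \<Rightarrow> real) \<Rightarrow> real"
  assumes sequential: "sequential_norm nrm"
    and norm_bounds: "\<And>u. u \<in> fin_seqs \<Longrightarrow> sup_norm u \<le> nrm u \<and> nrm u \<le> l1_norm u"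
begin

lemma nrm_nonneg: "u \<in> fin_seqs \<Longrightarrow> 0 \<le> nrm u"
  using sequential by (auto simp: sequential_norm_def)

lemma nrm_scale: "u \<in> fin_seqs \<Longrightarrow> nrm (\<lambda>i. c * u i) = \<bar>c\<bar> * nrm u"
  using sequential by (auto simp: sequential_norm_def)

lemma nrm_triangle: "u \<in> fin_seqs \<Longrightarrow> v \<in> fin_seqs \<Longrightarrow> nrm (\<lambda>i. u i + v i) \<le> nrm u + nrm v"
  using sequential by (auto simp: sequential_norm_def)

lemma nrm_eq_0_iff: "u \<in> fin_seqs \<Longrightarrow> nrm u = 0 \<longleftrightarrow> u = (\<lambda>i. 0)"
  using sequential by (auto simp: sequential_norm_def)

lemma nrm_lincomb_le:
  assumes "finite J" "\<And>j. j \<in> J \<Longrightarrow> v j \<in> fin_seqs"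
  shows "nrm (\<lambda>i. \<Sum>j\<in>J. c j * v j i) \<le> (\<Sum>j\<in>J. \<bar>c j\<bar> * nrm (v j))"
  using assms
proof (induction J rule: finite_induct)
  case empty
  have "(\<lambda>i. 0) \<in> fin_seqs" by (simp add: fin_seqs_def)
  then show ?case using nrm_eq_0_iff[of "\<lambda>i. 0"] by simp
next
  case (insert j J)
  have "nrm (\<lambda>i. c j * v j i + (\<Sum>j\<in>J. c j * v j i)) \<le>
      nrm (\<lambda>i. c j * v j i) + nrm (\<lambda>i. \<Sum>j\<in>J. c j * v j i)"
    using insert by (intro nrm_triangle fin_seqs_scale fin_seqs_lincomb) auto
  with insert show ?case by (simp add: nrm_scale)
qed

lemma nrm_mat_vec_le: "nrm (mat_vec n B u) \<le> (\<Sum>j=1..n. \<bar>u j\<bar> * nrm (mat_col n B j))"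
  unfolding mat_vec_eq_lincomb by (rule nrm_lincomb_le) auto

text \<open>Reverse triangle inequality: the contribution of column \<open>k\<close> is the full
  image minus that of the other columns. It gives the lower half of the one-big-jump
  estimate.\<close>

lemma nrm_mat_vec_ge:
  assumes "k \<in> {1..n}"
  shows "\<bar>u k\<bar> * nrm (mat_col n B k) - (\<Sum>j\<in>{1..n} - {k}. \<bar>u j\<bar> * nrm (mat_col n B j))
    \<le> nrm (mat_vec n B u)"
proof -
  let ?r = "\<lambda>i. \<Sum>j\<in>{1..n} - {k}. - u j * mat_col n B j i"
  have "(\<lambda>i. u k * mat_col n B k i) = (\<lambda>i. mat_vec n B u i + ?r i)"
    using assms
    by (auto simp: mat_vec_eq_lincomb fun_eq_iff sum.remove[of _ k] sum_negf)
  then have "\<bar>u k\<bar> * nrm (mat_col n B k) = nrm (\<lambda>i. mat_vec n B u i + ?r i)"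
    by (metis nrm_scale mat_col_in_fin_seqs)
  also have "\<dots> \<le> nrm (mat_vec n B u) + nrm ?r"
    by (intro nrm_triangle fin_seqs_lincomb) auto
  also have "nrm ?r \<le> (\<Sum>j\<in>{1..n} - {k}. \<bar>- u j\<bar> * nrm (mat_col n B j))"
    by (rule nrm_lincomb_le) auto
  finally show ?thesis by simp
qed

text \<open>Each coordinate is at most the norm of the vector, because the norm dominates the
  supremum norm. The resulting bound is independent of \<open>u\<close> and makes the supremum in
  \<open>op_norm\<close> finite.\<close>

lemma op_norm_quotient_le:
  "nrm (mat_vec n B (fin_vec n u)) / nrm (fin_vec n u) \<le> (\<Sum>j=1..n. nrm (mat_col n B j))"
proof (cases "nrm (fin_vec n u) = 0")
  \<comment> \<open>Division by zero has the value 0, which is below a sum of nonnegative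
    terms.\<close>
  case True
  then show ?thesis by (simp add: sum_nonneg nrm_nonneg)
next
  case False
  then have pos: "nrm (fin_vec n u) > 0" using nrm_nonneg[of "fin_vec n u"] by simp
  have "\<bar>u j\<bar> \<le> nrm (fin_vec n u)" if "j \<in> {1..n}" for j
  proof -
    have "\<bar>u j\<bar> = \<bar>fin_vec n u j\<bar>" using that by (simp add: fin_vec_def)
    also have "\<dots> \<le> nrm (fin_vec n u)"
      using abs_le_sup_norm[of "fin_vec n u" j] norm_bounds[of "fin_vec n u"] by simp
    finally show ?thesis .
  qed
  then have "(\<Sum>j=1..n. \<bar>u j\<bar> * nrm (mat_col n B j))
      \<le> (\<Sum>j=1..n. nrm (fin_vec n u) * nrm (mat_col n B j))"
    by (intro sum_mono mult_right_mono) (auto simp: nrm_nonneg)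
  with nrm_mat_vec_le[of n B u]
  have "nrm (mat_vec n B u) \<le> (\<Sum>j=1..n. nrm (mat_col n B j)) * nrm (fin_vec n u)"
    by (simp add: sum_distrib_left mult.commute)
  with pos show ?thesis by (simp add: divide_le_eq)
qed

lemma bdd_above_op_norm:
  "bdd_above ((\<lambda>u. nrm (mat_vec n B u) / nrm u) ` (range (fin_vec n) - {\<lambda>i. 0}))"
  using op_norm_quotient_le by (intro bdd_aboveI2[where M="\<Sum>j=1..n. nrm (mat_col n B j)"]) blast

text \<open>Passing from \<open>nrm\<close> to the l1 norm lets coordinates below a common level
  contribute at most \<open>n\<close> times that level. The zero vector is split off because the
  supremum excludes it; this also covers \<open>n = 0\<close>, where the supremum is over the empty
  set.\<close>

lemma nrm_mat_vec_le_op_norm: "nrm (mat_vec n B u) \<le> op_norm nrm n B * (\<Sum>i=1..n. \<bar>u i\<bar>)"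
proof (cases "fin_vec n u = (\<lambda>i. 0)")
  case True
  then have "\<And>i. i \<in> {1..n} \<Longrightarrow> u i = 0" by (metis fin_vec_def)
  with nrm_mat_vec_le[of n B u] show ?thesis by simp
next
  case False
  then have pos: "nrm (fin_vec n u) > 0"
    using nrm_nonneg[of "fin_vec n u"] nrm_eq_0_iff[of "fin_vec n u"] by simp
  have q: "nrm (mat_vec n B (fin_vec n u)) / nrm (fin_vec n u) \<le> op_norm nrm n B"
    unfolding op_norm_def using False by (intro cSUP_upper bdd_above_op_norm) auto
  have "0 \<le> nrm (mat_vec n B (fin_vec n u)) / nrm (fin_vec n u)"
    using pos by (simp add: nrm_nonneg)
  with q have nn: "0 \<le> op_norm nrm n B" by linarith
  have "nrm (mat_vec n B u) \<le> op_norm nrm n B * nrm (fin_vec n u)"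
    using q pos by (simp add: divide_le_eq)
  also have "\<dots> \<le> op_norm nrm n B * (\<Sum>i=1..n. \<bar>u i\<bar>)"
    using norm_bounds[of "fin_vec n u"] nn by (intro mult_left_mono) (auto simp: l1_norm_fin_vec)
  finally show ?thesis .
qed

lemma op_norm_nonneg:
  assumes "n \<ge> 1"
  shows "0 \<le> op_norm nrm n B"
proof -
  have "0 \<le> nrm (mat_vec n B (\<lambda>_. 1))" by (simp add: nrm_nonneg)
  also have "\<dots> \<le> op_norm nrm n B * real n"
    using nrm_mat_vec_le_op_norm[of n B "\<lambda>_. 1"] by simp
  finally show ?thesis using assms by (simp add: zero_le_mult_iff)
qed

text \<open>Lipschitz continuity follows from the l1 upper bound on the norm. It is the source of
  continuity and then of measurability.\<close>

lemma abs_nrm_fin_vec_diff_le: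
  "\<bar>nrm (fin_vec n u) - nrm (fin_vec n v)\<bar> \<le> (\<Sum>i=1..n. \<bar>u i - v i\<bar>)"
proof -
  have le: "nrm (fin_vec n u) - nrm (fin_vec n v) \<le> (\<Sum>i=1..n. \<bar>u i - v i\<bar>)" for u v
  proof -
    have "fin_vec n u = (\<lambda>i. fin_vec n v i + fin_vec n (\<lambda>i. u i - v i) i)"
      by (auto simp: fin_vec_def)
    then have "nrm (fin_vec n u) \<le> nrm (fin_vec n v) + nrm (fin_vec n (\<lambda>i. u i - v i))"
      using nrm_triangle[of "fin_vec n v" "fin_vec n (\<lambda>i. u i - v i)"] by simp
    also have "nrm (fin_vec n (\<lambda>i. u i - v i)) \<le> (\<Sum>i=1..n. \<bar>u i - v i\<bar>)"
      using norm_bounds[of "fin_vec n (\<lambda>i. u i - v i)"] by (simp add: l1_norm_fin_vec)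
    finally show ?thesis by simp
  qed
  show ?thesis using le[of u v] le[of v u] by (simp add: abs_le_iff abs_minus_commute)
qed

lemma continuous_nrm_fin_vec: "continuous_on UNIV (\<lambda>u::nat \<Rightarrow> real. nrm (fin_vec n u))"
proof -
  have "((\<lambda>v. nrm (fin_vec n v)) \<longlongrightarrow> nrm (fin_vec n u)) (at u)" for u
  proof (rule Lim_transform_bound[where g="\<lambda>v. \<Sum>i=1..n. \<bar>v i - u i\<bar>", THEN Lim_null[THEN iffD2]])
    show "\<forall>\<^sub>F v in at u. norm (nrm (fin_vec n v) - nrm (fin_vec n u)) \<le> norm (\<Sum>i=1..n. \<bar>v i - u i\<bar>)"
      by (rule always_eventually)
        (metis abs_nrm_fin_vec_diff_le abs_ge_self order_trans real_norm_def)
    have "((\<lambda>v. v i) \<longlongrightarrow> u i) (at u)" for i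
      using continuous_on_product_coordinates[of i] by (metis UNIV_I continuous_on)
    then have "((\<lambda>v. \<Sum>i=1..n. \<bar>v i - u i\<bar>) \<longlongrightarrow> (\<Sum>i=1..n. \<bar>u i - u i\<bar>)) (at u)"
      by (intro tendsto_intros)
    then show "((\<lambda>v. \<Sum>i=1..n. \<bar>v i - u i\<bar>) \<longlongrightarrow> 0) (at u)" by simp
  qed
  then show ?thesis by (auto simp: continuous_on_def)
qed

text \<open>The countable product sigma-algebra on sequences is the Borel one of the product
  topology, so coordinatewise measurability can be composed with continuity.\<close>

lemma borel_measurable_nrm_fin_vec:
  assumes "\<And>i. i \<in> {1..n} \<Longrightarrow> (\<lambda>x. f x i) \<in> borel_measurable M"
  shows "(\<lambda>x. nrm (fin_vec n (f x))) \<in> borel_measurable M"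
proof -
  have "(\<lambda>x. fin_vec n (f x)) \<in> M \<rightarrow>\<^sub>M PiM UNIV (\<lambda>_. borel)"
  proof (rule measurable_PiM_single')
    show "(\<lambda>x. fin_vec n (f x) i) \<in> borel_measurable M" for i
      using assms by (cases "i \<in> {1..n}") (auto simp: fin_vec_def)
  qed auto
  then have "(\<lambda>x. fin_vec n (f x)) \<in> borel_measurable M"
    by (simp add: measurable_cong_sets[OF refl sets_PiM_equal_borel])
  from measurable_compose[OF this borel_measurable_continuous_onI[OF continuous_nrm_fin_vec[of n]]]
  show ?thesis by (simp add: fin_vec_def cong: if_cong)
qed

lemma borel_measurable_nrm_mat_vec:
  assumes "\<And>i j. i \<in> {1..n} \<Longrightarrow> j \<in> {1..n} \<Longrightarrow> (\<lambda>x. B x i j) \<in> borel_measurable M"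
    and "\<And>j. j \<in> {1..n} \<Longrightarrow> (\<lambda>x. u x j) \<in> borel_measurable M"
  shows "(\<lambda>x. nrm (mat_vec n (B x) (u x))) \<in> borel_measurable M"
  unfolding mat_vec_def using assms
  by (intro borel_measurable_nrm_fin_vec borel_measurable_sum borel_measurable_times) auto

end

subsection \<open>Potter bound\<close>

text \<open>About \<open>log 2 c\<close> doublings lead from \<open>x / c\<close> past
  \<open>x\<close>, each at the cost of a factor \<open>2 powr p\<close>, hence
  \<open>c powr p\<close> in total up to a constant.\<close>

lemma antimono_doubling_bound:
  fixes G :: "real \<Rightarrow> real"
  assumes anti: "\<And>x y. x \<le> y \<Longrightarrow> G y \<le> G x"
    and le1: "\<And>x. G x \<le> 1"
    and pos: "0 < x0" "0 < G x0" and p: "0 \<le> p"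
    and double: "\<And>y. y \<ge> x0 \<Longrightarrow> G y \<le> 2 powr p * G (2 * y)"
    and x: "x0 \<le> x" and c: "1 \<le> c"
  shows "G (x / c) \<le> 2 powr p / G x0 * c powr p * G x"
proof -
  have iter: "G y \<le> (2 ^ m) powr p * G (2 ^ m * y)" if "y \<ge> x0" for y m
  proof (induction m)
    case 0
    then show ?case by simp
  next
    case (Suc m)
    have "1 * x0 \<le> 2 ^ m * y" using pos that by (intro mult_mono) auto
    then have "G (2 ^ m * y) \<le> 2 powr p * G (2 * (2 ^ m * y))" by (intro double) simp
    then have step: "(2 ^ m) powr p * G (2 ^ m * y) \<le> (2 ^ m) powr p * (2 powr p * G (2 * (2 ^ m * y)))"
      by (intro mult_left_mono) auto
    note Suc.IH also note step
    also have "(2 ^ m) powr p * (2 powr p * G (2 * (2 ^ m * y))) = (2 ^ Suc m) powr p * G (2 ^ Suc m * y)" by (simp add: powr_mult mult_ac)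
    finally show ?case .
  qed
  \<comment> \<open>Doubling is available only from \<open>x0\<close> on, so the starting point is
    raised to \<open>x0\<close> if \<open>x / c\<close> lies below it.\<close>
  define y where "y = max (x / c) x0"
  have y: "x0 \<le> y" "0 < y" "y \<le> x" "x / c \<le> y"
    using x c pos by (auto simp: y_def divide_le_eq mult_le_cancel_left1)
  have "x / c * c \<le> y * c" using y c by (intro mult_right_mono) auto
  then have yc: "x / y \<le> c" using c y by (simp add: divide_le_eq mult.commute)
  \<comment> \<open>The least \<open>m\<close> with \<open>x / y \<le> 2 ^ m\<close>; rounding up
    costs at most a factor 2, which becomes \<open>2 powr p\<close> in the constant.\<close>
  define m where "m = nat \<lceil>log 2 (x / y)\<rceil>"
  have xy: "1 \<le> x / y" using y by simp
  have lognn: "0 \<le> log 2 (x / y)" using xy by simp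
  have m1: "log 2 (x / y) \<le> real m" unfolding m_def by linarith
  have m2: "real m \<le> log 2 (x / y) + 1" unfolding m_def using lognn by linarith
  have low: "x / y \<le> 2 ^ m"
    using m1 xy by (simp add: log_le_iff powr_realpow)
  have up: "2 ^ m \<le> 2 * c"
  proof -
    have "2 ^ m = 2 powr real m" by (simp add: powr_realpow)
    also have "\<dots> \<le> 2 powr (log 2 (x / y) + 1)" using m2 by simp
    also have "\<dots> = 2 * (x / y)" using xy y by (simp add: powr_add)
    finally show ?thesis using yc by linarith
  qed
  \<comment> \<open>By iteration \<open>G\<close> is positive at every \<open>2 ^ k * x0\<close>,
    and one of these points lies beyond \<open>x\<close>.\<close>
  have Gx: "0 \<le> G x"
  proof -
    obtain k :: nat where "x / x0 < 2 ^ k" using real_arch_pow[of 2 "x / x0"] by auto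
    then have "x \<le> 2 ^ k * x0" using pos by (simp add: divide_less_eq)
    then have "G (2 ^ k * x0) \<le> G x" by (rule anti)
    moreover have "0 < (2 ^ k) powr p * G (2 ^ k * x0)" using iter[of x0 k] pos by linarith
    ultimately show ?thesis by (simp add: zero_less_mult_iff)
  qed
  have "G y \<le> (2 ^ m) powr p * G (2 ^ m * y)" using iter y by blast
  also have "\<dots> \<le> (2 ^ m) powr p * G x"
    using low y by (intro mult_left_mono anti) (auto simp: divide_le_eq)
  also have "\<dots> \<le> (2 * c) powr p * G x"
    using up Gx p by (intro mult_right_mono powr_mono2) auto
  finally have Gy: "G y \<le> 2 powr p * c powr p * G x" using c by (simp add: powr_mult)
  \<comment> \<open>Below \<open>x0\<close> the bound by 1 is used, which is where the division by
    \<open>G x0\<close> comes from; above it the division only weakens the bound, as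
    \<open>G x0 \<le> 1\<close>.\<close>
  have "G (x / c) \<le> G y / G x0"
  proof (cases "x0 \<le> x / c")
    case True
    then have "y = x / c" "0 \<le> G y" using Gx anti[of y x] y by (auto simp: y_def)
    then show ?thesis using le1[of x0] pos
      by (simp add: le_divide_eq mult_left_le)
  next
    case False
    then have "y = x0" by (simp add: y_def)
    then show ?thesis using le1[of "x / c"] pos by simp
  qed
  also have "\<dots> \<le> 2 powr p * c powr p * G x / G x0"
    using Gy pos by (simp add: divide_right_mono)
  finally show ?thesis by simp
qed

text \<open>The ratio \<open>G (2 * x) / G x\<close> tends to \<open>2 powr (- \<alpha>)\<close>,
  which exceeds \<open>2 powr (- p)\<close> since \<open>\<alpha> < p\<close>. So the doubling
  inequality with exponent \<open>p\<close> holds from some point on.\<close>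

lemma regularly_varying_potter:
  assumes rv: "regularly_varying G (- \<alpha>)"
    and anti: "\<And>x y. x \<le> y \<Longrightarrow> G y \<le> G x"
    and le1: "\<And>x. G x \<le> 1"
    and p: "\<alpha> < p" "0 \<le> p"
  obtains K x0 where "0 \<le> K" "\<And>x c. x0 \<le> x \<Longrightarrow> 1 \<le> c \<Longrightarrow> G (x / c) \<le> K * c powr p * G x"
proof -
  from rv obtain a where a: "\<And>x. x \<ge> a \<Longrightarrow> 0 < G x" by (auto simp: regularly_varying_def)
  have lim: "((\<lambda>x. G (2 * x) / G x) \<longlongrightarrow> 2 powr (- \<alpha>)) at_top"
    using rv by (auto simp: regularly_varying_def)
  have "2 powr (- p) < 2 powr (- \<alpha>)" using p by simp
  from order_tendstoD(1)[OF lim this]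
  obtain b where b: "\<And>x. x \<ge> b \<Longrightarrow> 2 powr (- p) < G (2 * x) / G x"
    by (auto simp: eventually_at_top_linorder)
  \<comment> \<open>Beyond \<open>a\<close> the tail is positive, beyond \<open>b\<close> doubling
    holds; the entry 1 keeps \<open>x0\<close> positive.\<close>
  define x0 where "x0 = Max {1, a, b}"
  have x0: "1 \<le> x0" "a \<le> x0" "b \<le> x0" by (auto simp: x0_def)
  have dbl: "G y \<le> 2 powr p * G (2 * y)" if "y \<ge> x0" for y
  proof -
    have "0 < G y" "2 powr (- p) < G (2 * y) / G y" using a b x0 that by auto
    then have "2 powr (- p) * G y \<le> G (2 * y)" by (simp add: less_divide_eq)
    then have "2 powr p * (2 powr (- p) * G y) \<le> 2 powr p * G (2 * y)" by simp
    moreover have "2 powr p * (2 powr (- p) * G y) = G y"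
      by (simp add: powr_minus field_simps)
    ultimately show ?thesis by simp
  qed
  show ?thesis
  proof (rule that[of "2 powr p / G x0" x0])
    show "0 \<le> 2 powr p / G x0" using a[OF x0(2)] by simp
    show "G (x / c) \<le> 2 powr p / G x0 * c powr p * G x" if "x0 \<le> x" "1 \<le> c" for x c
      by (rule antimono_doubling_bound) (use that x0 a p anti le1 dbl in auto)
  qed
qed

subsection \<open>Tails of linear images under a fixed matrix\<close>

context intermediate_norm
begin

text \<open>
  The threshold \<open>e\<close> is small enough that all coordinates below \<open>e x\<close> together move the norm by
  at most \<open>d x\<close>.
\<close>

lemma one_big_jump_indicators:
  fixes u :: "nat \<Rightarrow> real"
  assumes u: "\<And>i. i \<in> {1..n} \<Longrightarrow> 0 \<le> u i" and x: "0 < x" and d: "0 < d" "d < 1"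
    and b: "b = (\<lambda>k. nrm (mat_col n B k))"
    and e: "e = d / (1 + (\<Sum>k=1..n. b k))"
    and pairs: "pairs = {(i, j). i \<in> {1..n} \<and> j \<in> {1..n} \<and> i \<noteq> j}"
  shows "of_bool (nrm (mat_vec n B u) > x)
      \<le> (\<Sum>k=1..n. of_bool (b k * u k > (1 - d) * x)) +
        (\<Sum>(i, j)\<in>pairs. of_bool (u i > e * x \<and> u j > e * x) :: real)" (is "?N \<le> ?U + ?P")
    and "(\<Sum>k=1..n. of_bool (b k * u k > (1 + d) * x))
      \<le> of_bool (nrm (mat_vec n B u) > x) +
        real n * (\<Sum>(i, j)\<in>pairs. of_bool (u i > e * x \<and> u j > e * x))" (is "?L \<le> _")
proof -
  have fin: "finite pairs"
    by (rule finite_subset[of _ "{1..n} \<times> {1..n}"]) (auto simp: pairs)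
  have b0: "0 \<le> b k" for k by (simp add: b nrm_nonneg)
  define S where "S = (\<Sum>k=1..n. b k)"
  have S0: "0 \<le> S" unfolding S_def by (intro sum_nonneg b0)
  have bS: "b k \<le> S" if "k \<in> {1..n}" for k
    unfolding S_def using that b0 by (intro member_le_sum) auto
  \<comment> \<open>The 1 in the denominator keeps \<open>e\<close> positive when all columns
    vanish, and \<open>e * S \<le> d\<close> still holds.\<close>
  have e': "e = d / (1 + S)" by (simp add: e S_def)
  have e0: "0 < e" using d S0 by (simp add: e')
  have eS: "e * S \<le> d" using d S0 by (simp add: e' divide_le_eq algebra_simps)
  have P0: "0 \<le> ?P" by (intro sum_nonneg) auto
  have U0: "0 \<le> ?U" by (intro sum_nonneg) auto
  have P1: "1 \<le> ?P" if "(i, j) \<in> pairs" "u i > e * x" "u j > e * x" for i j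
  proof -
    have "(case (i, j) of (i, j) \<Rightarrow> of_bool (u i > e * x \<and> u j > e * x)) \<le> ?P"
      using that fin by (intro member_le_sum) auto
    with that show ?thesis by simp
  qed
  have small: "(\<Sum>j\<in>J. \<bar>u j\<bar> * b j) \<le> d * x"
    if "J \<subseteq> {1..n}" "\<And>j. j \<in> J \<Longrightarrow> u j \<le> e * x" for J
  proof -
    have "\<bar>u j\<bar> \<le> e * x" if "j \<in> J" for j
    proof -
      have "0 \<le> u j" using \<open>J \<subseteq> {1..n}\<close> \<open>j \<in> J\<close> u by blast
      with \<open>\<And>j. j \<in> J \<Longrightarrow> u j \<le> e * x\<close>[OF \<open>j \<in> J\<close>] show ?thesis by simp
    qed
    then have "(\<Sum>j\<in>J. \<bar>u j\<bar> * b j) \<le> (\<Sum>j\<in>J. e * x * b j)"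
      using b0 by (intro sum_mono mult_right_mono) auto
    also have "\<dots> \<le> (\<Sum>j=1..n. e * x * b j)"
      using that b0 e0 x by (intro sum_mono2) auto
    also have "\<dots> = e * S * x" by (simp add: S_def sum_distrib_left mult_ac)
    also have "\<dots> \<le> d * x" using eS x by (intro mult_right_mono) auto
    finally show ?thesis .
  qed
  \<comment> \<open>No column norm exceeds \<open>S\<close>, so a contribution above
    \<open>d * x\<close> forces its coordinate over the threshold.\<close>
  have big: "u k > e * x" if "k \<in> {1..n}" "b k * u k > d * x" for k
  proof (rule ccontr)
    assume "\<not> u k > e * x"
    then have "b k * u k \<le> b k * (e * x)" using b0 by (intro mult_left_mono) auto
    also have "\<dots> \<le> S * (e * x)" using bS that e0 x by (intro mult_right_mono) auto
    also have "\<dots> = e * S * x" by simp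
    also have "\<dots> \<le> d * x" using eS x by (intro mult_right_mono) auto
    finally show False using that by simp
  qed
  \<comment> \<open>A single pair event already contributes 1, so \<open>?P < 1\<close> leaves at
    most one coordinate above the threshold.\<close>
  have other: "u j \<le> e * x" if "?P < 1" "k \<in> {1..n}" "u k > e * x" "j \<in> {1..n} - {k}" for j k
    using P1[of k j] that by (force simp: pairs)
  show "?N \<le> ?U + ?P"
  proof (cases "nrm (mat_vec n B u) > x \<and> ?P < 1")
    \<comment> \<open>Either the indicator on the left is 0 or the pair sum alone is at least
      1.\<close>
    case False
    then show ?thesis using P0 U0 by (auto simp: not_less)
  next
    case True
    have up: "x < (\<Sum>j=1..n. \<bar>u j\<bar> * b j)"
      using True nrm_mat_vec_le[of n B u] by (simp add: b)
    obtain k where k: "k \<in> {1..n}" "u k > e * x"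
    proof (rule ccontr)
      assume "\<not> thesis"
      then have "\<And>j. j \<in> {1..n} \<Longrightarrow> u j \<le> e * x" using that by force
      from small[OF order_refl this] have "(\<Sum>j=1..n. \<bar>u j\<bar> * b j) \<le> d * x" .
      moreover have "d * x < 1 * x" using d x by (intro mult_strict_right_mono) auto
      ultimately show False using up by simp
    qed
    have "(\<Sum>j\<in>{1..n} - {k}. \<bar>u j\<bar> * b j) \<le> d * x"
      using True k other by (intro small) auto
    moreover have "(\<Sum>j=1..n. \<bar>u j\<bar> * b j) = \<bar>u k\<bar> * b k + (\<Sum>j\<in>{1..n} - {k}. \<bar>u j\<bar> * b j)"
      using k by (simp add: sum.remove)
    ultimately have "b k * u k > (1 - d) * x"
      using up u[OF k(1)] by (simp add: algebra_simps)
    then have "1 = (of_bool (b k * u k > (1 - d) * x) :: real)" by simp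
    also have "\<dots> \<le> ?U" using k by (intro member_le_sum) auto
    finally show ?thesis using P0 True by simp
  qed
  show "?L \<le> ?N + real n * ?P"
  proof (cases "?P < 1")
    case False
    \<comment> \<open>All \<open>n\<close> indicators may equal 1 here, hence the factor
      \<open>n\<close> in front of the pair sum.\<close>
    have "?L \<le> real (card {1..n}) * 1" by (rule sum_bounded_above) auto
    also have "\<dots> \<le> real n * ?P" using False by (intro mult_mono) auto
    finally show ?thesis by auto
  next
    case True
    show ?thesis
    proof (cases "\<exists>k\<in>{1..n}. b k * u k > (1 + d) * x")
      case False
      then have "?L = 0" by (intro sum.neutral) auto
      then show ?thesis using P0 by simp
    next
      case ex: True
      then obtain k where k: "k \<in> {1..n}" "b k * u k > (1 + d) * x" by blast
      have dx: "d * x < (1 + d) * x" using x by simp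
      have uk: "u k > e * x" using k dx by (intro big) auto
      have sm: "u j \<le> e * x" if "j \<in> {1..n} - {k}" for j
        using other[OF True k(1) uk that] .
      then have "\<not> b j * u j > (1 + d) * x" if "j \<in> {1..n} - {k}" for j
        using big[of j] that dx by force
      \<comment> \<open>With a single jump at \<open>k\<close> the sum counts it once; the others
        contribute at most \<open>d * x\<close>, so the norm still exceeds \<open>x\<close>.\<close>
      then have "?L = (\<Sum>j\<in>{k}. of_bool (b j * u j > (1 + d) * x))"
        using k by (intro sum.mono_neutral_right) auto
      then have L1: "?L = 1" using k by simp
      have "(\<Sum>j\<in>{1..n} - {k}. \<bar>u j\<bar> * b j) \<le> d * x" using sm by (intro small) auto
      moreover have "\<bar>u k\<bar> * b k > (1 + d) * x" using k u by (simp add: mult.commute)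
      ultimately have "x < nrm (mat_vec n B u)"
        using nrm_mat_vec_ge[OF k(1), of u B] by (simp add: b algebra_simps)
      then show ?thesis using L1 P0 by simp
    qed
  qed
qed

end

text \<open>Two limits in succession: for fixed \<open>d\<close> the bounds converge along
  \<open>F\<close>, and only afterwards does \<open>d\<close> tend to 0. The point from which the
  bounds hold may depend on \<open>d\<close>.\<close>

lemma tendsto_sandwich_family:
  fixes f :: "'a \<Rightarrow> real"
  assumes lower: "\<And>d::real. d \<in> {0<..<1} \<Longrightarrow> \<forall>\<^sub>F x in F. l d x \<le> f x"
    and upper: "\<And>d::real. d \<in> {0<..<1} \<Longrightarrow> \<forall>\<^sub>F x in F. f x \<le> u d x"
    and lim_l: "\<And>d::real. d \<in> {0<..<1} \<Longrightarrow> (l d \<longlongrightarrow> l' d) F"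
    and lim_u: "\<And>d::real. d \<in> {0<..<1} \<Longrightarrow> (u d \<longlongrightarrow> u' d) F"
    and l': "(l' \<longlongrightarrow> y) (at_right (0::real))" and u': "(u' \<longlongrightarrow> y) (at_right (0::real))"
  shows "(f \<longlongrightarrow> y) F"
proof (rule order_tendstoI)
  have ev: "\<forall>\<^sub>F d in at_right (0::real). d \<in> {0<..<1}"
    using eventually_at_right_real[of 0 1] by simp
  fix z
  {
    assume "z < y"
    from eventually_happens'[OF _ eventually_conj[OF ev order_tendstoD(1)[OF l' this]]]
    obtain d where d: "d \<in> {0<..<1}" "z < l' d" by auto
    from order_tendstoD(1)[OF lim_l[OF d(1)] d(2)] lower[OF d(1)]
    show "\<forall>\<^sub>F x in F. z < f x" by eventually_elim simp
  next
    assume "y < z"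
    from eventually_happens'[OF _ eventually_conj[OF ev order_tendstoD(2)[OF u' this]]]
    obtain d where d: "d \<in> {0<..<1}" "u' d < z" by auto
    from order_tendstoD(2)[OF lim_u[OF d(1)] d(2)] upper[OF d(1)]
    show "\<forall>\<^sub>F x in F. f x < z" by eventually_elim simp
  }
qed

section \<open>Tails of single coordinates and of pairs under regular variation\<close>

locale asymptotically_independent_tails = prob_space M for M :: "'w measure" +
  fixes X :: "nat \<Rightarrow> 'w \<Rightarrow> real" and G :: "real \<Rightarrow> real" and \<alpha> :: real
  assumes X_meas [measurable]: "\<And>i. i \<ge> 1 \<Longrightarrow> X i \<in> borel_measurable M"
    and X_nonneg: "\<And>i. i \<ge> 1 \<Longrightarrow> AE \<omega> in M. 0 \<le> X i \<omega>"
    and X_tail: "\<And>i x. i \<ge> 1 \<Longrightarrow> prob {\<omega>\<in>space M. X i \<omega> > x} = G x"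
    and \<alpha>_pos: "\<alpha> > 0"
    and rv: "regularly_varying G (- \<alpha>)"
    and pair_tail: "\<And>i j. i \<ge> 1 \<Longrightarrow> j \<ge> 1 \<Longrightarrow> i \<noteq> j \<Longrightarrow>
      ((\<lambda>x. prob {\<omega>\<in>space M. X i \<omega> > x \<and> X j \<omega> > x} / G x) \<longlongrightarrow> 0) at_top"
begin

lemma G_antimono: "x \<le> y \<Longrightarrow> G y \<le> G x"
  using X_tail[of 1] by (auto simp flip: X_tail[of 1] intro!: finite_measure_mono)

lemma G_le_1: "G x \<le> 1"
  using X_tail[of 1 x] prob_le_1[of "{\<omega>\<in>space M. X 1 \<omega> > x}"] by simp

lemma G_nonneg: "0 \<le> G x"
  using X_tail[of 1 x] measure_nonneg[of M "{\<omega>\<in>space M. X 1 \<omega> > x}"] by simp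

lemma G_pos: "\<forall>\<^sub>F x in at_top. 0 < G x"
  using rv by (auto simp: regularly_varying_def eventually_at_top_linorder)

lemma G_scale: "t > 0 \<Longrightarrow> ((\<lambda>x. G (t * x) / G x) \<longlongrightarrow> t powr (- \<alpha>)) at_top"
  using rv by (auto simp: regularly_varying_def)

lemma AE_X_nonneg: "AE \<omega> in M. \<forall>i\<in>{1..n}. 0 \<le> X i \<omega>"
  by (rule AE_finite_allI) (auto intro: X_nonneg)

text \<open>Regular variation is applied with ratio \<open>c / b\<close>, which the negative
  exponent inverts. For \<open>b = 0\<close> the event is empty once \<open>x > 0\<close>, in
  agreement with \<open>0 powr \<alpha> = 0\<close>.\<close>

lemma scaled_tail:
  assumes "i \<ge> 1" "0 \<le> b" "0 < c"
  shows "((\<lambda>x. prob {\<omega>\<in>space M. b * X i \<omega> > c * x} / G x) \<longlongrightarrow> (b / c) powr \<alpha>) at_top"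
proof (cases "b = 0")
  case True
  have "\<forall>\<^sub>F x in at_top. prob {\<omega>\<in>space M. b * X i \<omega> > c * x} / G x = 0"
    using eventually_gt_at_top[of 0] by eventually_elim (use True assms in \<open>auto simp: not_less mult_less_0_iff\<close>)
  then show ?thesis using True by (simp add: tendsto_eventually)
next
  case False
  with assms have b: "0 < b" by simp
  then have "b * y > c * x \<longleftrightarrow> y > c / b * x" for x y by (simp add: field_simps)
  then have "prob {\<omega>\<in>space M. b * X i \<omega> > c * x} = G (c / b * x)" for x
    using X_tail[OF assms(1), of "c / b * x"] by simp
  moreover have "(c / b) powr (- \<alpha>) = (b / c) powr \<alpha>"
    using b assms by (simp add: powr_minus powr_divide)
  ultimately show ?thesis using G_scale[of "c / b"] b assms by simp
qed

text \<open>Rescaling the threshold multiplies a ratio tending to 0 by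
  \<open>G (e * x) / G x\<close>, which has a finite limit.\<close>

lemma scaled_pair_tail:
  assumes "i \<ge> 1" "j \<ge> 1" "i \<noteq> j" "0 < e"
  shows "((\<lambda>x. prob {\<omega>\<in>space M. X i \<omega> > e * x \<and> X j \<omega> > e * x} / G x) \<longlongrightarrow> 0) at_top"
proof -
  let ?p = "\<lambda>x. prob {\<omega>\<in>space M. X i \<omega> > x \<and> X j \<omega> > x}"
  have ex: "filterlim (\<lambda>x. e * x) at_top at_top"
    using assms by (intro filterlim_tendsto_pos_mult_at_top[OF tendsto_const]) (auto simp: filterlim_ident)
  have "((\<lambda>x. (?p (e * x) / G (e * x)) * (G (e * x) / G x)) \<longlongrightarrow> 0 * e powr (- \<alpha>)) at_top"
    by (intro tendsto_mult G_scale filterlim_compose[OF pair_tail ex] assms)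
  moreover have "\<forall>\<^sub>F x in at_top. (?p (e * x) / G (e * x)) * (G (e * x) / G x) = ?p (e * x) / G x"
    using filterlim_iff[THEN iffD1, OF ex, rule_format, OF G_pos] by eventually_elim simp
  ultimately have "((\<lambda>x. ?p (e * x) / G x) \<longlongrightarrow> 0 * e powr (- \<alpha>)) at_top"
    by (rule Lim_transform_eventually)
  then show ?thesis by simp
qed

end

lemma (in prob_space) prob_eq_integral_of_bool:
  assumes "Measurable.pred M P"
  shows "prob {\<omega>\<in>space M. P \<omega>} = (\<integral>\<omega>. of_bool (P \<omega>) \<partial>M)"
proof -
  have "prob {\<omega>\<in>space M. P \<omega>} = (\<integral>\<omega>. indicator {\<omega>\<in>space M. P \<omega>} \<omega> \<partial>M)"
    using assms by simp
  also have "\<dots> = (\<integral>\<omega>. of_bool (P \<omega>) \<partial>M)"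
    by (rule Bochner_Integration.integral_cong) (auto simp: indicator_def)
  finally show ?thesis .
qed

lemma (in prob_space) integrable_of_bool:
  assumes "Measurable.pred M P"
  shows "integrable M (\<lambda>\<omega>. of_bool (P \<omega>) :: real)"
proof (rule integrable_const_bound[of _ 1])
  show "(\<lambda>\<omega>. of_bool (P \<omega>) :: real) \<in> borel_measurable M"
    using assms by (simp add: of_bool_def)
qed auto

section \<open>Tail asymptotics and a tail bound for a fixed matrix\<close>

locale asymptotically_independent_norm =
  asymptotically_independent_tails M X G \<alpha> + intermediate_norm nrm
  for M :: "'w measure" and X G \<alpha> nrm
begin

lemma borel_measurable_nrm_mat_vec_X [measurable]:
  "(\<lambda>\<omega>. nrm (mat_vec n B (\<lambda>i. X i \<omega>))) \<in> borel_measurable M"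
  by (intro borel_measurable_nrm_mat_vec) auto

text \<open>Expectations of the pointwise indicator bounds; since coordinates are nonnegative only
  almost everywhere, the integrands are compared almost everywhere.\<close>

lemma one_big_jump_prob:
  assumes x: "0 < x" and d: "0 < d" "d < 1"
    and b: "b = (\<lambda>k. nrm (mat_col n B k))"
    and e: "e = d / (1 + (\<Sum>k=1..n. b k))"
    and pairs: "pairs = {(i, j). i \<in> {1..n} \<and> j \<in> {1..n} \<and> i \<noteq> j}"
  shows "prob {\<omega>\<in>space M. nrm (mat_vec n B (\<lambda>i. X i \<omega>)) > x}
      \<le> (\<Sum>k=1..n. prob {\<omega>\<in>space M. b k * X k \<omega> > (1 - d) * x}) +
        (\<Sum>(i, j)\<in>pairs. prob {\<omega>\<in>space M. X i \<omega> > e * x \<and> X j \<omega> > e * x})" (is "?N \<le> ?U + ?P")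
    and "(\<Sum>k=1..n. prob {\<omega>\<in>space M. b k * X k \<omega> > (1 + d) * x})
      \<le> prob {\<omega>\<in>space M. nrm (mat_vec n B (\<lambda>i. X i \<omega>)) > x} +
        real n * (\<Sum>(i, j)\<in>pairs. prob {\<omega>\<in>space M. X i \<omega> > e * x \<and> X j \<omega> > e * x})" (is "?L \<le> _")
proof -
  have fin: "finite pairs"
    by (rule finite_subset[of _ "{1..n} \<times> {1..n}"]) (auto simp: pairs)
  have mN: "Measurable.pred M (\<lambda>\<omega>. nrm (mat_vec n B (\<lambda>i. X i \<omega>)) > x)" by measurable
  have mX: "Measurable.pred M (\<lambda>\<omega>. b k * X k \<omega> > c)" if "k \<in> {1..n}" for k c
  proof -
    \<comment> \<open>The simplifier's form of \<open>1 \<le> k\<close>, the side condition for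
      measurability of \<open>X k\<close>.\<close>
    have [simp]: "Suc 0 \<le> k" using that by simp
    show ?thesis by measurable
  qed
  have mP: "Measurable.pred M (\<lambda>\<omega>. X (fst q) \<omega> > e * x \<and> X (snd q) \<omega> > e * x)"
    if "q \<in> pairs" for q
  proof -
    have [simp]: "Suc 0 \<le> fst q" "Suc 0 \<le> snd q" using that by (auto simp: pairs)
    show ?thesis by measurable
  qed
  have intP: "integrable M (\<lambda>\<omega>. \<Sum>q\<in>pairs. of_bool (X (fst q) \<omega> > e * x \<and> X (snd q) \<omega> > e * x) :: real)"
    by (intro Bochner_Integration.integrable_sum integrable_of_bool mP)
  have intX: "integrable M (\<lambda>\<omega>. \<Sum>k=1..n. of_bool (b k * X k \<omega> > c) :: real)" for c
    by (intro Bochner_Integration.integrable_sum integrable_of_bool mX)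
  have N: "?N = (\<integral>\<omega>. of_bool (nrm (mat_vec n B (\<lambda>i. X i \<omega>)) > x) \<partial>M)"
    by (rule prob_eq_integral_of_bool[OF mN])
  have S: "(\<Sum>k=1..n. prob {\<omega>\<in>space M. b k * X k \<omega> > c})
      = (\<integral>\<omega>. (\<Sum>k=1..n. of_bool (b k * X k \<omega> > c)) \<partial>M)" for c
    by (subst Bochner_Integration.integral_sum)
      (auto intro!: sum.cong integrable_of_bool mX prob_eq_integral_of_bool)
  have P: "?P = (\<integral>\<omega>. (\<Sum>q\<in>pairs. of_bool (X (fst q) \<omega> > e * x \<and> X (snd q) \<omega> > e * x)) \<partial>M)"
    unfolding case_prod_beta
    by (subst Bochner_Integration.integral_sum)
      (auto intro!: sum.cong integrable_of_bool mP prob_eq_integral_of_bool simp del: of_bool_conj)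
  have "?N \<le> (\<integral>\<omega>. (\<Sum>k=1..n. of_bool (b k * X k \<omega> > (1 - d) * x)) +
      (\<Sum>q\<in>pairs. of_bool (X (fst q) \<omega> > e * x \<and> X (snd q) \<omega> > e * x)) \<partial>M)"
    unfolding N
    by (intro integral_mono_AE integrable_of_bool mN Bochner_Integration.integrable_add intX intP)
      (rule AE_mp[OF AE_X_nonneg[of n]], rule AE_I2, rule impI,
        rule one_big_jump_indicators(1)[OF _ x d b e pairs, unfolded case_prod_beta], blast)
  also have "\<dots> = ?U + ?P"
    unfolding S P by (rule Bochner_Integration.integral_add[OF intX intP])
  finally show "?N \<le> ?U + ?P" .
  have "?L \<le> (\<integral>\<omega>. of_bool (nrm (mat_vec n B (\<lambda>i. X i \<omega>)) > x) +
      real n * (\<Sum>q\<in>pairs. of_bool (X (fst q) \<omega> > e * x \<and> X (snd q) \<omega> > e * x)) \<partial>M)"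
    unfolding S
    by (intro integral_mono_AE integrable_of_bool mN Bochner_Integration.integrable_add intX intP
        integrable_mult_right)
      (rule AE_mp[OF AE_X_nonneg[of n]], rule AE_I2, rule impI,
        rule one_big_jump_indicators(2)[OF _ x d b e pairs, unfolded case_prod_beta], blast)
  also have "\<dots> = ?N + real n * ?P"
    unfolding N P
    by (simp only: Bochner_Integration.integral_add[OF integrable_of_bool[OF mN] integrable_mult_right[OF intP]]
        integral_mult_right_zero)
  finally show "?L \<le> ?N + real n * ?P" .
qed

text \<open>After division by \<open>G x\<close> the finitely many pair terms vanish and the
  single-jump terms tend to \<open>(b k / (1 - d)) powr \<alpha>\<close> above and
  \<open>(b k / (1 + d)) powr \<alpha>\<close> below; these meet as \<open>d\<close> tends to
  0.\<close>

lemma deterministic_matrix_tail: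
  "((\<lambda>x. prob {\<omega>\<in>space M. nrm (mat_vec n B (\<lambda>i. X i \<omega>)) > x} / G x)
    \<longlongrightarrow> (\<Sum>k=1..n. nrm (mat_col n B k) powr \<alpha>)) at_top"
proof -
  define b where "b = (\<lambda>k. nrm (mat_col n B k))"
  define e where "e d = d / (1 + (\<Sum>k=1..n. b k))" for d
  define pairs where "pairs = {(i, j). i \<in> {1..n} \<and> j \<in> {1..n} \<and> i \<noteq> j}"
  let ?f = "\<lambda>x. prob {\<omega>\<in>space M. nrm (mat_vec n B (\<lambda>i. X i \<omega>)) > x}"
  let ?S = "\<lambda>c x. \<Sum>k=1..n. prob {\<omega>\<in>space M. b k * X k \<omega> > c * x}"
  let ?P = "\<lambda>d x. \<Sum>(i, j)\<in>pairs. prob {\<omega>\<in>space M. X i \<omega> > e d * x \<and> X j \<omega> > e d * x}"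
  have b0: "0 \<le> b k" for k by (simp add: b_def nrm_nonneg)
  have e0: "0 < e d" if "0 < d" for d
    using that sum_nonneg[of "{1..n}" b] b0 by (auto simp: e_def intro!: divide_pos_pos add_pos_nonneg)
  have limS: "((\<lambda>x. ?S c x / G x) \<longlongrightarrow> (\<Sum>k=1..n. (b k / c) powr \<alpha>)) at_top" if "0 < c" for c
    unfolding sum_divide_distrib using that b0 by (intro tendsto_sum scaled_tail) auto
  have limP: "((\<lambda>x. ?P d x / G x) \<longlongrightarrow> 0) at_top" if "0 < d" for d
  proof -
    have "((\<lambda>x. ?P d x / G x) \<longlongrightarrow> (\<Sum>q\<in>pairs. 0)) at_top"
      unfolding sum_divide_distrib case_prod_beta
      using e0[OF that] by (intro tendsto_sum scaled_pair_tail) (auto simp: pairs_def)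
    then show ?thesis by simp
  qed
  have "((\<lambda>x. ?f x / G x) \<longlongrightarrow> (\<Sum>k=1..n. b k powr \<alpha>)) at_top"
  proof (rule tendsto_sandwich_family)
    fix d :: real assume d: "d \<in> {0<..<1}"
    show "\<forall>\<^sub>F x in at_top. ?S (1 + d) x / G x - real n * (?P d x / G x) \<le> ?f x / G x"
      using eventually_gt_at_top[of 0] G_pos
    proof eventually_elim
      case (elim x)
      with one_big_jump_prob(2)[OF _ _ _ b_def e_def pairs_def, of x d] d
      have "?S (1 + d) x - real n * ?P d x \<le> ?f x" by simp
      then have "(?S (1 + d) x - real n * ?P d x) / G x \<le> ?f x / G x"
        using elim by (intro divide_right_mono) auto
      then show ?case by (simp add: diff_divide_distrib)
    qed
    show "\<forall>\<^sub>F x in at_top. ?f x / G x \<le> ?S (1 - d) x / G x + ?P d x / G x"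
      using eventually_gt_at_top[of 0] G_pos
    proof eventually_elim
      case (elim x)
      with one_big_jump_prob(1)[OF _ _ _ b_def e_def pairs_def, of x d] d
      have "?f x \<le> ?S (1 - d) x + ?P d x" by simp
      then have "?f x / G x \<le> (?S (1 - d) x + ?P d x) / G x"
        using elim by (intro divide_right_mono) auto
      then show ?case by (simp add: add_divide_distrib)
    qed
    show "((\<lambda>x. ?S (1 + d) x / G x - real n * (?P d x / G x))
        \<longlongrightarrow> (\<Sum>k=1..n. (b k / (1 + d)) powr \<alpha>) - real n * 0) at_top"
      using d by (intro tendsto_intros limS limP) auto
    show "((\<lambda>x. ?S (1 - d) x / G x + ?P d x / G x)
        \<longlongrightarrow> (\<Sum>k=1..n. (b k / (1 - d)) powr \<alpha>) + 0) at_top"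
      using d by (intro tendsto_intros limS limP) auto
  next
    \<comment> \<open>The values 1 and -1 of \<open>s\<close> serve the lower and the upper
      bound.\<close>
    have lim: "((\<lambda>d. \<Sum>k=1..n. (b k / (1 + s * d)) powr \<alpha>) \<longlongrightarrow> (\<Sum>k=1..n. b k powr \<alpha>)) (at_right 0)" for s
    proof (intro tendsto_sum)
      fix k
      have "((\<lambda>d. b k / (1 + s * d)) \<longlongrightarrow> b k / (1 + s * 0)) (at_right 0)"
        by (intro tendsto_intros) auto
      then have l: "((\<lambda>d. b k / (1 + s * d)) \<longlongrightarrow> b k) (at_right 0)" by simp
      \<comment> \<open>The convergence rule for \<open>powr\<close> asks for a nonzero limit of the
        base, so zero columns are separated.\<close>
      show "((\<lambda>d. (b k / (1 + s * d)) powr \<alpha>) \<longlongrightarrow> b k powr \<alpha>) (at_right 0)"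
        by (cases "b k = 0") (use l in \<open>auto intro!: tendsto_powr\<close>)
    qed
    show "((\<lambda>d. (\<Sum>k=1..n. (b k / (1 + d)) powr \<alpha>) - real n * 0) \<longlongrightarrow> (\<Sum>k=1..n. b k powr \<alpha>)) (at_right 0)"
      using lim[of 1] by simp
    show "((\<lambda>d. (\<Sum>k=1..n. (b k / (1 - d)) powr \<alpha>) + 0) \<longlongrightarrow> (\<Sum>k=1..n. b k powr \<alpha>)) (at_right 0)"
      using lim[of "-1"] by simp
  qed
  then show ?thesis by (simp add: b_def)
qed

text \<open>If every coordinate is at most \<open>x / c\<close> with \<open>c\<close> at least
  \<open>n\<close> times the operator norm, the image has norm at most \<open>x\<close>; the rest is
  a union bound. The maximum with 1 avoids division by zero and meets the condition
  \<open>1 \<le> c\<close> of the Potter bound.\<close>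

lemma deterministic_matrix_tail_bound:
  assumes n: "n \<ge> 1" and x: "x > 0"
  shows "prob {\<omega>\<in>space M. nrm (mat_vec n B (\<lambda>i. X i \<omega>)) > x}
    \<le> real n * G (x / max 1 (real n * op_norm nrm n B))"
proof -
  define c where "c = max 1 (real n * op_norm nrm n B)"
  have c: "1 \<le> c" "real n * op_norm nrm n B \<le> c" by (auto simp: c_def)
  have "prob {\<omega>\<in>space M. nrm (mat_vec n B (\<lambda>i. X i \<omega>)) > x}
      \<le> prob (\<Union>i\<in>{1..n}. {\<omega>\<in>space M. X i \<omega> > x / c})"
  proof (rule finite_measure_mono_AE)
    show "AE \<omega> in M. \<omega> \<in> {\<omega>\<in>space M. nrm (mat_vec n B (\<lambda>i. X i \<omega>)) > x} \<longrightarrow>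
        \<omega> \<in> (\<Union>i\<in>{1..n}. {\<omega>\<in>space M. X i \<omega> > x / c})"
      using AE_X_nonneg[of n]
    proof eventually_elim
      case (elim \<omega>)
      have "nrm (mat_vec n B (\<lambda>i. X i \<omega>)) \<le> x" if "\<And>i. i \<in> {1..n} \<Longrightarrow> X i \<omega> \<le> x / c"
      proof -
        have "nrm (mat_vec n B (\<lambda>i. X i \<omega>)) \<le> op_norm nrm n B * (\<Sum>i=1..n. \<bar>X i \<omega>\<bar>)"
          by (rule nrm_mat_vec_le_op_norm)
        also have "\<dots> \<le> op_norm nrm n B * (\<Sum>i=1..n. x / c)"
          using elim that op_norm_nonneg[OF n] by (intro mult_left_mono sum_mono) auto
        also have "\<dots> = (real n * op_norm nrm n B) * (x / c)" by simp
        also have "\<dots> \<le> c * (x / c)" using c x by (intro mult_right_mono) auto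
        also have "\<dots> = x" using c by simp
        finally show ?thesis .
      qed
      then show ?case by (force simp: not_less)
    qed
    show "(\<Union>i\<in>{1..n}. {\<omega>\<in>space M. X i \<omega> > x / c}) \<in> events"
      by (intro sets.finite_UN) auto
  qed
  also have "\<dots> \<le> (\<Sum>i=1..n. prob {\<omega>\<in>space M. X i \<omega> > x / c})"
    by (intro measure_UNION_le) auto
  also have "\<dots> = real n * G (x / c)" by (simp add: X_tail)
  finally show ?thesis by (simp add: c_def)
qed

end

subsection \<open>Random matrices\<close>

text \<open>Grouping: the sigma-algebra generated by \<open>U\<close> and \<open>W\<close> together
  is independent of that of \<open>V\<close>, so the joint law agrees with the product law on
  rectangles and hence everywhere.\<close>

lemma (in prob_space) indep_three_distr_pair:
  assumes "indep_three M K U L V R W"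
  shows "distr M (K \<Otimes>\<^sub>M R) (\<lambda>\<omega>. (U \<omega>, W \<omega>)) \<Otimes>\<^sub>M distr M L V
    = distr M ((K \<Otimes>\<^sub>M R) \<Otimes>\<^sub>M L) (\<lambda>\<omega>. ((U \<omega>, W \<omega>), V \<omega>))" (is "?DT \<Otimes>\<^sub>M ?DV = ?J")
proof -
  have [measurable]: "U \<in> M \<rightarrow>\<^sub>M K" "V \<in> M \<rightarrow>\<^sub>M L" "W \<in> M \<rightarrow>\<^sub>M R"
    using assms by (auto simp: indep_three_def)
  define E where "E k = [sets (vimage_algebra (space M) U K), sets (vimage_algebra (space M) V L),
      sets (vimage_algebra (space M) W R)] ! k" for k :: nat
  \<comment> \<open>\<open>True\<close> collects the positions of \<open>U\<close> and
    \<open>W\<close>, \<open>False\<close> that of \<open>V\<close>.\<close>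
  define I :: "bool \<Rightarrow> nat set" where "I j = (if j then {0, 2} else {1})" for j
  have "(\<Union>j\<in>UNIV. I j) = {0, 1, 2}" by (auto simp: I_def UNIV_bool)
  then have "indep_sets E (\<Union>j\<in>UNIV. I j)"
    using assms by (simp add: indep_three_def E_def[abs_def])
  moreover have "Int_stable (E i)" if "i \<in> I j" for i j
  proof -
    have "i \<in> {0, 1, 2}" using that by (auto simp: I_def split: if_splits)
    then have "E i \<in> range (sets :: 'a measure \<Rightarrow> _)" by (auto simp: E_def numeral_2_eq_2)
    then show ?thesis by (auto simp: Int_stable_def)
  qed
  moreover have "disjoint_family I" by (auto simp: disjoint_family_on_def I_def)
  ultimately have ind: "indep_sets (\<lambda>j. sigma_sets (space M) (\<Union>i\<in>I j. E i)) UNIV"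
    by (intro indep_sets_collect_sigma) auto
  have E0: "{U -` A \<inter> space M |A. A \<in> sets K} \<subseteq> E 0"
    and E1: "{V -` A \<inter> space M |A. A \<in> sets L} \<subseteq> E 1"
    and E2: "{W -` A \<inter> space M |A. A \<in> sets R} \<subseteq> E 2"
    by (auto simp: E_def sets_vimage_algebra)
  \<comment> \<open>Both \<open>U\<close> and \<open>W\<close> are measurable for \<open>S\<close>,
    so every event about the pair belongs to the first group.\<close>
  define S where "S = sigma (space M) (E 0 \<union> E 2)"
  have E_Pow: "E 0 \<union> E 2 \<subseteq> Pow (space M)"
    by (auto simp: E_def numeral_2_eq_2 dest!: sets.sets_into_space)
  have S: "space S = space M" "sets S = sigma_sets (space M) (E 0 \<union> E 2)"
    using E_Pow by (simp_all add: S_def space_measure_of sets_measure_of)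
  have sub: "E 0 \<subseteq> sets S" "E 2 \<subseteq> sets S" by (auto simp: S)
  have "U \<in> S \<rightarrow>\<^sub>M K"
    by (rule measurableI) (use E0 sub measurable_space[of U M K] in \<open>auto simp: S(1)\<close>)
  moreover have "W \<in> S \<rightarrow>\<^sub>M R"
    by (rule measurableI) (use E2 sub measurable_space[of W M R] in \<open>auto simp: S(1)\<close>)
  ultimately have pair: "(\<lambda>\<omega>. (U \<omega>, W \<omega>)) \<in> S \<rightarrow>\<^sub>M K \<Otimes>\<^sub>M R" by simp
  have "sigma_sets (space M) {(\<lambda>\<omega>. (U \<omega>, W \<omega>)) -` A \<inter> space M |A. A \<in> sets (K \<Otimes>\<^sub>M R)} \<subseteq> sets S"
    unfolding S(1)[symmetric]
    by (rule sets.sigma_sets_subset) (use measurable_sets[OF pair] in auto)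
  moreover have "sigma_sets (space M) {V -` A \<inter> space M |A. A \<in> sets L} \<subseteq> sigma_sets (space M) (E 1)"
    using E1 by (rule sigma_sets_mono')
  ultimately have "indep_set
      (sigma_sets (space M) {(\<lambda>\<omega>. (U \<omega>, W \<omega>)) -` A \<inter> space M |A. A \<in> sets (K \<Otimes>\<^sub>M R)})
      (sigma_sets (space M) {V -` A \<inter> space M |A. A \<in> sets L})"
    unfolding indep_set_def
    by (intro indep_sets_mono_sets[OF ind]) (auto simp: I_def S split: bool.splits)
  then have indep: "prob (a \<inter> b) = prob a * prob b"
    if "a \<in> {(\<lambda>\<omega>. (U \<omega>, W \<omega>)) -` A \<inter> space M |A. A \<in> sets (K \<Otimes>\<^sub>M R)}"
      "b \<in> {V -` A \<inter> space M |A. A \<in> sets L}" for a b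
    using that unfolding indep_sets2_eq by (blast intro: sigma_sets.Basic)
  show ?thesis
  proof (rule pair_measure_eqI)
    show "sigma_finite_measure ?DT" "sigma_finite_measure ?DV"
      by (intro prob_space_imp_sigma_finite prob_space_distr; simp)+
    show "sets (?DT \<Otimes>\<^sub>M ?DV) = sets ?J" by (simp cong: sets_pair_measure_cong)
    fix A B assume AB: "A \<in> sets ?DT" "B \<in> sets ?DV"
    then have [measurable]: "A \<in> sets (K \<Otimes>\<^sub>M R)" "B \<in> sets L" by simp_all
    let ?a = "(\<lambda>\<omega>. (U \<omega>, W \<omega>)) -` A \<inter> space M" and ?b = "V -` B \<inter> space M"
    have "emeasure ?DT A * emeasure ?DV B = ennreal (prob ?a * prob ?b)"
      by (simp add: emeasure_distr emeasure_eq_measure ennreal_mult)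
    also have "prob ?a * prob ?b = prob (?a \<inter> ?b)"
      using AB by (intro indep[symmetric]) auto
    also have "?a \<inter> ?b = (\<lambda>\<omega>. ((U \<omega>, W \<omega>), V \<omega>)) -` (A \<times> B) \<inter> space M" by auto
    also have "ennreal (prob \<dots>) = emeasure ?J (A \<times> B)"
      by (simp add: emeasure_distr emeasure_eq_measure)
    finally show "emeasure ?DT A * emeasure ?DV B = emeasure ?J (A \<times> B)" .
  qed
qed

text \<open>Fubini for the product law: \<open>T\<close> is frozen at an outer sample point while
  \<open>V\<close> is resampled at an inner one.\<close>

lemma (in prob_space)
  assumes T [measurable]: "T \<in> M \<rightarrow>\<^sub>M S" and V [measurable]: "V \<in> M \<rightarrow>\<^sub>M L"
    and prod: "distr M S T \<Otimes>\<^sub>M distr M L V = distr M (S \<Otimes>\<^sub>M L) (\<lambda>\<omega>. (T \<omega>, V \<omega>))"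
    and Q [measurable]: "Measurable.pred (S \<Otimes>\<^sub>M L) Q"
  shows prob_eq_integral_prob_slice:
      "prob {\<omega>\<in>space M. Q (T \<omega>, V \<omega>)} = (\<integral>\<omega>. prob {\<omega>'\<in>space M. Q (T \<omega>, V \<omega>')} \<partial>M)"
    and borel_measurable_prob_slice:
      "(\<lambda>\<omega>. prob {\<omega>'\<in>space M. Q (T \<omega>, V \<omega>')}) \<in> borel_measurable M"
proof -
  interpret V: prob_space "distr M L V" by (rule prob_space_distr) simp
  let ?Q = "{z \<in> space (S \<Otimes>\<^sub>M L). Q z}"
  have Qs: "?Q \<in> sets (S \<Otimes>\<^sub>M L)" by measurable
  then have Qs': "?Q \<in> sets (distr M S T \<Otimes>\<^sub>M distr M L V)"
    by (simp cong: sets_pair_measure_cong)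
  have slice: "emeasure (distr M L V) (Pair (T \<omega>) -` ?Q) = ennreal (prob {\<omega>'\<in>space M. Q (T \<omega>, V \<omega>')})"
    if "\<omega> \<in> space M" for \<omega>
  proof -
    have T: "T \<omega> \<in> space S" using that by (auto intro: measurable_space)
    have "emeasure (distr M L V) (Pair (T \<omega>) -` ?Q) = emeasure M (V -` (Pair (T \<omega>) -` ?Q) \<inter> space M)"
      by (intro emeasure_distr sets_Pair1[OF Qs]) auto
    also have "V -` (Pair (T \<omega>) -` ?Q) \<inter> space M = {\<omega>'\<in>space M. Q (T \<omega>, V \<omega>')}"
      using T by (auto simp: space_pair_measure intro: measurable_space)
    finally show ?thesis by (simp add: emeasure_eq_measure)
  qed
  have meas: "(\<lambda>t. emeasure (distr M L V) (Pair t -` ?Q)) \<in> borel_measurable S"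
    using V.measurable_emeasure_Pair[of ?Q S] Qs by (simp cong: sets_pair_measure_cong)
  have "(\<lambda>\<omega>. enn2real (emeasure (distr M L V) (Pair (T \<omega>) -` ?Q))) \<in> borel_measurable M"
    by (intro borel_measurable_enn2real measurable_compose[OF _ meas]) simp
  then show m: "(\<lambda>\<omega>. prob {\<omega>'\<in>space M. Q (T \<omega>, V \<omega>')}) \<in> borel_measurable M"
    by (rule measurable_cong[THEN iffD1, rotated]) (simp only: slice enn2real_ennreal measure_nonneg)
  have "ennreal (prob {\<omega>\<in>space M. Q (T \<omega>, V \<omega>)}) = emeasure M ((\<lambda>\<omega>. (T \<omega>, V \<omega>)) -` ?Q \<inter> space M)"
    unfolding emeasure_eq_measure
    by (intro arg_cong[where f="\<lambda>A. ennreal (prob A)"])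
      (auto simp: space_pair_measure intro: measurable_space)
  also have "\<dots> = emeasure (distr M S T \<Otimes>\<^sub>M distr M L V) ?Q"
    unfolding prod using Qs by (intro emeasure_distr[symmetric]) auto
  also have "\<dots> = (\<integral>\<^sup>+t. emeasure (distr M L V) (Pair t -` ?Q) \<partial>distr M S T)"
    by (rule V.emeasure_pair_measure_alt[OF Qs'])
  also have "\<dots> = (\<integral>\<^sup>+\<omega>. emeasure (distr M L V) (Pair (T \<omega>) -` ?Q) \<partial>M)"
    using meas by (intro nn_integral_distr) auto
  also have "\<dots> = (\<integral>\<^sup>+\<omega>. ennreal (prob {\<omega>'\<in>space M. Q (T \<omega>, V \<omega>')}) \<partial>M)"
    by (intro nn_integral_cong slice)
  also have "\<dots> = ennreal (\<integral>\<omega>. prob {\<omega>'\<in>space M. Q (T \<omega>, V \<omega>')} \<partial>M)"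
    using m by (intro nn_integral_eq_integral integrable_const_bound[of _ 1]) auto
  finally show "prob {\<omega>\<in>space M. Q (T \<omega>, V \<omega>)} = (\<integral>\<omega>. prob {\<omega>'\<in>space M. Q (T \<omega>, V \<omega>')} \<partial>M)"
    by (simp add: integral_nonneg_AE)
qed

text \<open>The matrices of all sizes enter the independence as one random element, indexed by
  \<open>mat_entries\<close>. The mean \<open>\<gamma>\<close> is an extended real because it is
  infinite for \<open>\<alpha> < 1\<close>.\<close>

theorem theorem10:
  fixes M :: "'w measure"
    and nrm :: "(nat \<Rightarrow> real) \<Rightarrow> real"
    and N :: "'w \<Rightarrow> nat"
    and X :: "nat \<Rightarrow> 'w \<Rightarrow> real"
    and A :: "nat \<Rightarrow> 'w \<Rightarrow> nat \<Rightarrow> nat \<Rightarrow> real"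
    and C :: "'w \<Rightarrow> nat \<Rightarrow> real"
    and \<alpha> :: real
    and \<gamma> :: ennreal
  assumes "prob_space M"
    and "sequential_norm nrm"
    and "\<And>u. u \<in> fin_seqs \<Longrightarrow> sup_norm u \<le> nrm u \<and> nrm u \<le> l1_norm u"
    and "N \<in> M \<rightarrow>\<^sub>M count_space {1..}"
    and "\<And>i. i \<ge> 1 \<Longrightarrow> X i \<in> borel_measurable M"
    and "\<And>i. i \<ge> 1 \<Longrightarrow> AE \<omega> in M. 0 \<le> X i \<omega>"
    and "\<And>n i j. (n, i, j) \<in> mat_entries \<Longrightarrow> (\<lambda>\<omega>. A n \<omega> i j) \<in> borel_measurable M"
    and "indep_three M
           (count_space {1..}) N
           (PiM {1..} (\<lambda>_. borel)) (\<lambda>\<omega>. \<lambda>i\<in>{1..}. X i \<omega>)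
           (PiM mat_entries (\<lambda>_. borel)) (\<lambda>\<omega>. \<lambda>(n, i, j)\<in>mat_entries. A n \<omega> i j)"
    and "C = (\<lambda>\<omega>. mat_vec (N \<omega>) (A (N \<omega>) \<omega>) (fin_vec (N \<omega>) (\<lambda>i. X i \<omega>)))"
    and "AE \<omega> in M. \<forall>i\<in>{1..N \<omega>}. 0 \<le> C \<omega> i"
    and "\<alpha> > 0"
    and "(\<integral>\<omega>. real (N \<omega>) \<partial>M) > 0"
    and "\<exists>\<epsilon>>0. integrable M (\<lambda>\<omega>. real (N \<omega>) powr (2 + \<alpha> + \<epsilon>))"
    and "\<And>i. i \<ge> 1 \<Longrightarrow> distr M borel (X i) = distr M borel (X 1)"
    and "\<And>i. i \<ge> 1 \<Longrightarrow> (\<integral>\<^sup>+\<omega>. ennreal (X i \<omega>) \<partial>M) = \<gamma>"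
    and "regularly_varying (\<lambda>x. measure M {\<omega>\<in>space M. X 1 \<omega> > x}) (- \<alpha>)"
    and "((\<lambda>x. SUP (i, j) \<in> {(i, j). i \<ge> 1 \<and> j \<ge> 1 \<and> i \<noteq> j}.
              measure M {\<omega>\<in>space M. X i \<omega> > x \<and> X j \<omega> > x}
                / measure M {\<omega>\<in>space M. X 1 \<omega> > x}) \<longlongrightarrow> 0) at_top"
    and "\<exists>\<epsilon>>0. integrable M (\<lambda>\<omega>. op_norm nrm (N \<omega>) (A (N \<omega>) \<omega>) powr (\<alpha> + \<epsilon>)
                                   * real (N \<omega>) powr (1 + \<alpha> + \<epsilon>))"
  shows "((\<lambda>x. measure M {\<omega>\<in>space M. nrm (C \<omega>) > x}
               / measure M {\<omega>\<in>space M. X 1 \<omega> > x})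
          \<longlongrightarrow> (\<integral>\<omega>. (\<Sum>k=1..N \<omega>. nrm (mat_col (N \<omega>) (A (N \<omega>) \<omega>) k) powr \<alpha>) \<partial>M)) at_top"
proof -
  note N [measurable] = \<open>N \<in> M \<rightarrow>\<^sub>M count_space {1..}\<close>
  note X_meas = \<open>\<And>i. i \<ge> 1 \<Longrightarrow> X i \<in> borel_measurable M\<close>
  note A_meas = \<open>\<And>n i j. (n, i, j) \<in> mat_entries \<Longrightarrow> (\<lambda>\<omega>. A n \<omega> i j) \<in> borel_measurable M\<close>
  define G where "G x = measure M {\<omega>\<in>space M. X 1 \<omega> > x}" for x
  interpret prob_space M by fact
  interpret intermediate_norm nrm by unfold_locales fact+
  have X_tail: "prob {\<omega>\<in>space M. X i \<omega> > x} = G x" if "i \<ge> 1" for i x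
  proof -
    have "prob {\<omega>\<in>space M. X i \<omega> > x} = measure (distr M borel (X i)) {x<..}" if "i \<ge> 1" for i
      using X_meas[OF that]
      by (subst measure_distr) (auto intro!: arg_cong[where f=prob])
    then show ?thesis using that assms(14)[OF that] by (simp add: G_def)
  qed
  have pair_tail: "((\<lambda>x. prob {\<omega>\<in>space M. X i \<omega> > x \<and> X j \<omega> > x} / G x) \<longlongrightarrow> 0) at_top"
    if ij: "i \<ge> 1" "j \<ge> 1" "i \<noteq> j" for i j
  proof (rule tendsto_sandwich[OF _ _ tendsto_const])
    let ?r = "\<lambda>x (i, j). prob {\<omega>\<in>space M. X i \<omega> > x \<and> X j \<omega> > x} / G x"
    let ?D = "{(i, j). i \<ge> 1 \<and> j \<ge> 1 \<and> i \<noteq> (j::nat)}"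
    show "((\<lambda>x. SUP q\<in>?D. ?r x q) \<longlongrightarrow> 0) at_top" using assms(17) by (simp add: G_def)
    \<comment> \<open>A real supremum dominates its members only over a bounded set. The bound also
      holds where \<open>G x = 0\<close>, the quotient then being 0.\<close>
    have "?r x q \<le> 1" if D: "q \<in> ?D" for x q
    proof -
      obtain k l where q: "q = (k, l)" "k \<ge> 1" using D by auto
      have "prob {\<omega>\<in>space M. X k \<omega> > x \<and> X l \<omega> > x} \<le> prob {\<omega>\<in>space M. X k \<omega> > x}"
        using X_meas[OF q(2)] by (intro finite_measure_mono) auto
      then show ?thesis using X_tail[OF q(2), of x] measure_nonneg[of M "{\<omega>\<in>space M. X k \<omega> > x}"]
        by (auto simp: q divide_le_eq)
    qed
    then have "?r x (i, j) \<le> (SUP q\<in>?D. ?r x q)" for x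
      using ij by (intro cSUP_upper bdd_aboveI2[where M=1]) auto
    then show "\<forall>\<^sub>F x in at_top. prob {\<omega>\<in>space M. X i \<omega> > x \<and> X j \<omega> > x} / G x \<le> (SUP q\<in>?D. ?r x q)"
      by simp
    show "\<forall>\<^sub>F x in at_top. 0 \<le> prob {\<omega>\<in>space M. X i \<omega> > x \<and> X j \<omega> > x} / G x"
      by (simp add: G_def)
  qed
  have rvG: "regularly_varying G (- \<alpha>)" using assms(16) by (simp add: G_def[abs_def])
  interpret asymptotically_independent_norm M X G \<alpha> nrm
    by unfold_locales (fact X_meas assms(6) X_tail \<open>\<alpha> > 0\<close> rvG pair_tail)+
  have N1: "N \<omega> \<ge> 1" if "\<omega> \<in> space M" for \<omega>
    using measurable_space[OF N that] by simp

  \<comment> \<open>The conditional tail given size and matrices: these stay at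
    \<open>\<omega>\<close>, and only \<open>X\<close> is averaged.\<close>
  define g where "g \<omega> x = prob {\<omega>'\<in>space M. nrm (mat_vec (N \<omega>) (A (N \<omega>) \<omega>) (\<lambda>i. X i \<omega>')) > x}" for \<omega> x
  have conditioning: "(\<lambda>\<omega>. g \<omega> x) \<in> borel_measurable M"
    "prob {\<omega>\<in>space M. nrm (C \<omega>) > x} = (\<integral>\<omega>. g \<omega> x \<partial>M)" for x
  proof -
    let ?S = "count_space {1..} \<Otimes>\<^sub>M PiM mat_entries (\<lambda>_. borel :: real measure)"
    let ?L = "PiM {1..} (\<lambda>_. borel :: real measure)"
    let ?T = "\<lambda>\<omega>. (N \<omega>, \<lambda>(n, i, j)\<in>mat_entries. A n \<omega> i j)"
    let ?V = "\<lambda>\<omega>. \<lambda>i\<in>{1::nat..}. X i \<omega>"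
    define h where "h n z = nrm (mat_vec n (\<lambda>i j. snd (fst z) (n, i, j)) (snd z))"
      for n and z :: "(nat \<times> (nat \<times> nat \<times> nat \<Rightarrow> real)) \<times> (nat \<Rightarrow> real)"
    have prod: "distr M ?S ?T \<Otimes>\<^sub>M distr M ?L ?V = distr M (?S \<Otimes>\<^sub>M ?L) (\<lambda>\<omega>. (?T \<omega>, ?V \<omega>))"
      using assms(8) by (rule indep_three_distr_pair)
    have T: "?T \<in> M \<rightarrow>\<^sub>M ?S" and V: "?V \<in> M \<rightarrow>\<^sub>M ?L"
      using assms(8) by (auto simp: indep_three_def)
    have h: "h n \<in> borel_measurable (?S \<Otimes>\<^sub>M ?L)" for n
      unfolding h_def
    proof (rule borel_measurable_nrm_mat_vec)
      fix i j assume ij: "i \<in> {1..n}" "j \<in> {1..n}"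
      then have "(\<lambda>e. e (n, i, j)) \<in> borel_measurable (PiM mat_entries (\<lambda>_. borel :: real measure))"
        by (intro measurable_component_singleton) (auto simp: mat_entries_def)
      from measurable_compose[OF _ this]
      show "(\<lambda>z. snd (fst z) (n, i, j)) \<in> borel_measurable (?S \<Otimes>\<^sub>M ?L)" by measurable
    next
      fix j assume j: "j \<in> {1..n}"
      then have "(\<lambda>e. e j) \<in> borel_measurable ?L"
        by (intro measurable_component_singleton) auto
      from measurable_compose[OF _ this]
      show "(\<lambda>z. snd z j) \<in> borel_measurable (?S \<Otimes>\<^sub>M ?L)" by measurable
    qed
    \<comment> \<open>The size has countably many values, so measurability for each fixed size is
      enough.\<close>
    have [measurable]: "(\<lambda>z. h (fst (fst z)) z) \<in> borel_measurable (?S \<Otimes>\<^sub>M ?L)"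
      by (rule measurable_compose_countable'[where I="{1..}", OF h]) auto
    have Q: "Measurable.pred (?S \<Otimes>\<^sub>M ?L) (\<lambda>z. h (fst (fst z)) z > x)" by measurable
    \<comment> \<open>\<open>mat_vec\<close> reads only indices in \<open>{1..n}\<close>, where the
      restricted families agree with the original ones.\<close>
    have h_eq: "h (N \<omega>) (?T \<omega>, ?V \<omega>') = nrm (mat_vec (N \<omega>) (A (N \<omega>) \<omega>) (\<lambda>i. X i \<omega>'))" for \<omega> \<omega>'
      unfolding h_def by (intro arg_cong[where f=nrm] mat_vec_cong) (auto simp: mat_entries_def)
    show "(\<lambda>\<omega>. g \<omega> x) \<in> borel_measurable M"
      using borel_measurable_prob_slice[OF T V prod Q] unfolding g_def fst_conv h_eq .
    show "prob {\<omega>\<in>space M. nrm (C \<omega>) > x} = (\<integral>\<omega>. g \<omega> x \<partial>M)"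
      using prob_eq_integral_prob_slice[OF T V prod Q] unfolding g_def fst_conv h_eq
      by (simp add: assms(9))
  qed

  from assms(18) obtain \<epsilon> where \<epsilon>: "\<epsilon> > 0"
    "integrable M (\<lambda>\<omega>. op_norm nrm (N \<omega>) (A (N \<omega>) \<omega>) powr (\<alpha> + \<epsilon>) * real (N \<omega>) powr (1 + \<alpha> + \<epsilon>))"
    by blast
  define p where "p = \<alpha> + \<epsilon>"
  have p: "\<alpha> < p" "0 \<le> p" using \<epsilon>(1) \<alpha>_pos by (auto simp: p_def)
  have intA: "integrable M (\<lambda>\<omega>. op_norm nrm (N \<omega>) (A (N \<omega>) \<omega>) powr p * real (N \<omega>) powr (1 + p))"
    using \<epsilon>(2) by (simp add: p_def add.assoc)
  obtain K x0 where K: "0 \<le> K" "\<And>x c. x0 \<le> x \<Longrightarrow> 1 \<le> c \<Longrightarrow> G (x / c) \<le> K * c powr p * G x"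
    using regularly_varying_potter[OF rv G_antimono G_le_1 p] by blast
  have N_meas [measurable]: "(\<lambda>\<omega>. real (N \<omega>)) \<in> borel_measurable M"
    by (rule measurable_compose[OF N]) simp
  have intN: "integrable M (\<lambda>\<omega>. real (N \<omega>))"
  proof -
    from assms(13) obtain \<delta> where \<delta>: "\<delta> > 0" "integrable M (\<lambda>\<omega>. real (N \<omega>) powr (2 + \<alpha> + \<delta>))" by blast
    \<comment> \<open>Powers with exponent at least 1 dominate because \<open>N\<close> is at least
      1.\<close>
    have "real (N \<omega>) \<le> real (N \<omega>) powr (2 + \<alpha> + \<delta>)" if "\<omega> \<in> space M" for \<omega>
      using powr_mono[of 1 "2 + \<alpha> + \<delta>" "real (N \<omega>)"] N1[OF that] \<alpha>_pos \<delta>(1) by simp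
    then show ?thesis
      by (intro Bochner_Integration.integrable_bound[OF \<delta>(2)]) auto
  qed

  have "((\<lambda>x. \<integral>\<omega>. g \<omega> x / G x \<partial>M)
      \<longlongrightarrow> (\<integral>\<omega>. (\<Sum>k=1..N \<omega>. nrm (mat_col (N \<omega>) (A (N \<omega>) \<omega>) k) powr \<alpha>) \<partial>M)) at_top"
  proof (rule integral_dominated_convergence_at_top)
    show "(\<lambda>\<omega>. \<Sum>k=1..N \<omega>. nrm (mat_col (N \<omega>) (A (N \<omega>) \<omega>) k) powr \<alpha>) \<in> borel_measurable M"
    proof (rule measurable_compose_countable'[OF _ N])
      fix n :: nat
      show "(\<lambda>\<omega>. \<Sum>k=1..n. nrm (mat_col n (A n \<omega>) k) powr \<alpha>) \<in> borel_measurable M"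
        unfolding mat_col_def
        by (intro borel_measurable_sum powr_real_measurable borel_measurable_const
            borel_measurable_nrm_fin_vec A_meas)
          (auto simp: mat_entries_def)
    qed auto
    show "(\<lambda>\<omega>. g \<omega> x / G x) \<in> borel_measurable M" for x
      using conditioning(1) by simp
    show "integrable M (\<lambda>\<omega>. K * (real (N \<omega>) +
        op_norm nrm (N \<omega>) (A (N \<omega>) \<omega>) powr p * real (N \<omega>) powr (1 + p)))"
      using intN intA by simp
    show "AE \<omega> in M. ((\<lambda>x. g \<omega> x / G x)
        \<longlongrightarrow> (\<Sum>k=1..N \<omega>. nrm (mat_col (N \<omega>) (A (N \<omega>) \<omega>) k) powr \<alpha>)) at_top"
      unfolding g_def by (intro AE_I2 deterministic_matrix_tail)
    \<comment> \<open>The thresholds 0 and \<open>x0\<close>, and the one for positivity of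
      \<open>G\<close>, do not depend on \<open>\<omega>\<close>, so one dominating function serves
      all large \<open>x\<close>.\<close>
    show "\<forall>\<^sub>F x in at_top. AE \<omega> in M. norm (g \<omega> x / G x)
        \<le> K * (real (N \<omega>) + op_norm nrm (N \<omega>) (A (N \<omega>) \<omega>) powr p * real (N \<omega>) powr (1 + p))"
      using G_pos eventually_gt_at_top[of 0] eventually_ge_at_top[of x0]
    proof eventually_elim
      case (elim x)
      show ?case
      proof (rule AE_I2)
        fix \<omega> assume \<omega>: "\<omega> \<in> space M"
        define n where "n = real (N \<omega>)"
        define a where "a = op_norm nrm (N \<omega>) (A (N \<omega>) \<omega>)"
        have n: "1 \<le> n" using N1[OF \<omega>] by (simp add: n_def)
        have a: "0 \<le> a" using op_norm_nonneg[OF N1[OF \<omega>]] by (simp add: a_def)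
        \<comment> \<open>The maximum is attained by one of its arguments. With the outer factor
          \<open>n\<close> the sum yields \<open>n\<close> and
          \<open>a powr p * n powr (1 + p)\<close>, the integrable terms from (i) and (iv).\<close>
        have c: "max 1 (n * a) powr p \<le> 1 + (n * a) powr p"
          by (simp add: max_def)
        have "g \<omega> x \<le> n * G (x / max 1 (n * a))"
          unfolding g_def n_def a_def
          by (rule deterministic_matrix_tail_bound[OF N1[OF \<omega>] elim(2)])
        also have "\<dots> \<le> n * (K * max 1 (n * a) powr p * G x)"
          using n by (intro mult_left_mono K(2) elim(3)) auto
        also have "\<dots> \<le> n * (K * (1 + (n * a) powr p) * G x)"
          using n K(1) elim(1) c by (intro mult_left_mono mult_right_mono) auto
        also have "\<dots> = K * (n + a powr p * n powr (1 + p)) * G x"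
          using n a by (simp add: powr_mult powr_add algebra_simps)
        finally have "g \<omega> x / G x \<le> K * (n + a powr p * n powr (1 + p))"
          using elim(1) by (simp add: divide_le_eq)
        moreover have "0 \<le> g \<omega> x / G x" using elim(1) by (simp add: g_def)
        ultimately show "norm (g \<omega> x / G x) \<le> K * (real (N \<omega>) +
            op_norm nrm (N \<omega>) (A (N \<omega>) \<omega>) powr p * real (N \<omega>) powr (1 + p))"
          by (simp add: n_def a_def)
      qed
    qed
  qed
  then show ?thesis by (simp add: conditioning(2) G_def)
qed

end
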